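(* Every SBE map (sublinear-Lipschitz equivalence) $f:X\to Y$ between quasimetric spaces is an AM-map (at infinity) with linear $\eta$, i.e. the AM-condition holds with a function of the form $\eta(t)=Lt$ for some constant $L>0$.
   Context: Quasimetric spaces. An extended metric on $X$ is $\rho:X\times X\to[0,\infty]$ for which there is at most one point $*_X$ (point at infinity) with $\rho(x,*_X)=\infty$ for $x\ne*_X$, $\rho( *_X,*_X)=0$, and whose restriction to $X\setminus\{*_X\}$ (finite points) is a metric. A quasimetric is a symmetric $d:X\times X\to\mathbb R\cup\{\infty\}$ with $\frac1K\rho\le d\le K\rho$ for some $K>0$ and some extended metric $\rho$. Spaces here are unbounded and equipped with a point at infinity; maps between the sets of finite points are extended by $f( *_X)=*_Y$. A finite origin $o\in X$ is fixed, $f(o)$ is taken as origin of $Y$, and $|x|=d(o,x)$. Admissible gauge: nondecreasing $u:\mathbb R_+\to\mathbb R$ with $\limsup_{r\to\infty}u(r)/r=0$. Sublinear-Lipschitz map $f:X\to Y$: there are an admissible gauge $u$ and constants $C,C'>0$ with $d(f(x),f(y))\le Cd(x,y)+C'u(|x|+|y|)$ for all (finite) $x,y\in X$. Two sublinear-Lipschitz maps $f,f':X\to Y$ are equivalent if $d(f(x),f'(x))\le C''v(|x|)$ for all $x$, for some admissible gauge $v$ and constant $C''>0$. Equivalence classes of sublinear-Lipschitz maps form a category; an SBE map is a map representing an isomorphism, i.e. a sublinear-Lipschitz $f:X\to Y$ for which there is a sublinear-Lipschitz $g:Y\to X$ with $g\circ f$ and $f\circ g$ equivalent to the identity maps. Cross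 ratio. For $x\ne w$, $y\ne z$ finite, $[x,y,z,w]=\frac{d(x,z)d(y,w)}{d(x,w)d(y,z)}$; it is $0$ if $x=z$ or $y=w$ (even if some points are at infinity); otherwise factors containing the point at infinity are omitted, e.g. $[x,y,z,*_X]=d(x,z)/d(y,z)$. Finite points $x,y$ are separated by a gauge $u$ if $d(x,y)>u(|x|+|y|)$; every finite point is separated from $*_X$. AM-map at infinity: there are an admissible gauge $u$ and a homeomorphism $\eta:[0,\infty)\to[0,\infty)$ with $[f(x),f(y),f(z),f(w)]<\eta([x,y,z,w])$ for all $x,y,z,w\in X$ pairwise separated by $u$ (the condition includes that the cross ratios involved are defined). *)

theory Defs
  imports "HOL-Analysis.Analysis"
begin

section \<open>Quasimetric spaces with a point at infinity\<close>

record 'a qspace =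
  points :: "'a set"
  infpt :: 'a
  qdist :: "'a \<Rightarrow> 'a \<Rightarrow> ennreal"

definition finpts :: "'a qspace \<Rightarrow> 'a set" where
  "finpts S = points S - {infpt S}"

text \<open>Meaningful on pairs of finite points, where the distance is finite.\<close>

definition fdist :: "'a qspace \<Rightarrow> 'a \<Rightarrow> 'a \<Rightarrow> real" where
  "fdist S x y = enn2real (qdist S x y)"

text \<open>An extended metric on \<open>X\<close> with point at infinity \<open>p\<close>. The locale
  \<open>Metric_space\<close> asks for nonnegativity and symmetry of a total function, so the
  restriction to the finite points is padded with \<open>0\<close> elsewhere.\<close>

definition extended_metric :: "'a set \<Rightarrow> 'a \<Rightarrow> ('a \<Rightarrow> 'a \<Rightarrow> ennreal) \<Rightarrow> bool" where
  "extended_metric X p \<rho> \<longleftrightarrow>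
     p \<in> X \<and> \<rho> p p = 0 \<and>
     (\<forall>x\<in>X - {p}. \<rho> x p = \<infinity> \<and> \<rho> p x = \<infinity>) \<and>
     (\<forall>x\<in>X - {p}. \<forall>y\<in>X - {p}. \<rho> x y \<noteq> \<infinity>) \<and>
     Metric_space (X - {p})
       (\<lambda>x y. if x \<in> X - {p} \<and> y \<in> X - {p} then enn2real (\<rho> x y) else 0)"

text \<open>A quasimetric is nonnegative by comparison with \<open>\<rho>\<close>, so no generality is lost by
  giving it values in \<^typ>\<open>ennreal\<close>.\<close>

definition quasimetric :: "'a set \<Rightarrow> 'a \<Rightarrow> ('a \<Rightarrow> 'a \<Rightarrow> ennreal) \<Rightarrow> bool" where
  "quasimetric X p d \<longleftrightarrow>
     (\<forall>x\<in>X. \<forall>y\<in>X. d x y = d y x) \<and>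
     (\<exists>\<rho> K. extended_metric X p \<rho> \<and> K > 0 \<and>
        (\<forall>x\<in>X. \<forall>y\<in>X. ennreal (1 / K) * \<rho> x y \<le> d x y \<and> d x y \<le> ennreal K * \<rho> x y))"

text \<open>Unboundedness refers to the finite points; including the point at infinity would make
  it void.\<close>

definition quasimetric_space :: "'a qspace \<Rightarrow> bool" where
  "quasimetric_space S \<longleftrightarrow>
     quasimetric (points S) (infpt S) (qdist S) \<and>
     (\<forall>B. \<exists>x\<in>finpts S. \<exists>y\<in>finpts S. fdist S x y > B)"

section \<open>Sublinear-Lipschitz maps and SBE maps\<close>

text \<open>Gauges are functions on \<open>[0,\<infinity>)\<close> and may take negative values.\<close>

definition admissible_gauge :: "(real \<Rightarrow> real) \<Rightarrow> bool" where
  "admissible_gauge u \<longleftrightarrow>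
     mono_on {0..} u \<and> Limsup at_top (\<lambda>r. ereal (u r / r)) = 0"

text \<open>Maps between the sets of finite points, extended by sending infinity to infinity.\<close>

definition infpt_map :: "'a qspace \<Rightarrow> 'b qspace \<Rightarrow> ('a \<Rightarrow> 'b) \<Rightarrow> bool" where
  "infpt_map S T f \<longleftrightarrow> f \<in> finpts S \<rightarrow> finpts T \<and> f (infpt S) = infpt T"

text \<open>Below, \<open>b\<close> is the origin of \<open>S\<close>, and \<open>fdist S b x\<close> is the quantity usually
  written \<open>|x|\<close>.\<close>

definition sublinear_lipschitz :: "'a qspace \<Rightarrow> 'a \<Rightarrow> 'b qspace \<Rightarrow> ('a \<Rightarrow> 'b) \<Rightarrow> bool" where
  "sublinear_lipschitz S b T f \<longleftrightarrow>
     infpt_map S T f \<and>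
     (\<exists>u C C'. admissible_gauge u \<and> C > 0 \<and> C' > 0 \<and>
        (\<forall>x\<in>finpts S. \<forall>y\<in>finpts S.
           fdist T (f x) (f y) \<le> C * fdist S x y + C' * u (fdist S b x + fdist S b y)))"

definition sublinear_equivalent ::
    "'a qspace \<Rightarrow> 'a \<Rightarrow> 'b qspace \<Rightarrow> ('a \<Rightarrow> 'b) \<Rightarrow> ('a \<Rightarrow> 'b) \<Rightarrow> bool" where
  "sublinear_equivalent S b T f f' \<longleftrightarrow>
     (\<exists>v C. admissible_gauge v \<and> C > 0 \<and>
        (\<forall>x\<in>finpts S. fdist T (f x) (f' x) \<le> C * v (fdist S b x)))"

definition SBE_map :: "'a qspace \<Rightarrow> 'a \<Rightarrow> 'b qspace \<Rightarrow> ('a \<Rightarrow> 'b) \<Rightarrow> bool" where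
  "SBE_map S b T f \<longleftrightarrow>
     sublinear_lipschitz S b T f \<and>
     (\<exists>g. sublinear_lipschitz T (f b) S g \<and>
        sublinear_equivalent S b S (g \<circ> f) id \<and>
        sublinear_equivalent T (f b) T (f \<circ> g) id)"

section \<open>Cross ratios and AM-maps at infinity\<close>

definition cross_ratio_defined :: "'a \<Rightarrow> 'a \<Rightarrow> 'a \<Rightarrow> 'a \<Rightarrow> bool" where
  "cross_ratio_defined x y z w \<longleftrightarrow> x \<noteq> w \<and> y \<noteq> z"

text \<open>Omitting a factor amounts to replacing it by \<open>1\<close>.\<close>

definition cr_factor :: "'a qspace \<Rightarrow> 'a \<Rightarrow> 'a \<Rightarrow> real" where
  "cr_factor S x y = (if x = infpt S \<or> y = infpt S then 1 else fdist S x y)"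

definition cross_ratio :: "'a qspace \<Rightarrow> 'a \<Rightarrow> 'a \<Rightarrow> 'a \<Rightarrow> 'a \<Rightarrow> real" where
  "cross_ratio S x y z w =
     (if x = z \<or> y = w then 0
      else (cr_factor S x z * cr_factor S y w) / (cr_factor S x w * cr_factor S y z))"

text \<open>The point at infinity is separated from every finite point, but not from itself.\<close>

definition separated :: "'a qspace \<Rightarrow> 'a \<Rightarrow> (real \<Rightarrow> real) \<Rightarrow> 'a \<Rightarrow> 'a \<Rightarrow> bool" where
  "separated S b u x y \<longleftrightarrow>
     (x \<in> finpts S \<and> y \<in> finpts S \<and> fdist S x y > u (fdist S b x + fdist S b y)) \<or>
     (x \<in> finpts S \<and> y = infpt S) \<or> (x = infpt S \<and> y \<in> finpts S)"

definition AM_map_at_infinity ::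
    "'a qspace \<Rightarrow> 'a \<Rightarrow> 'b qspace \<Rightarrow> ('a \<Rightarrow> 'b) \<Rightarrow> (real \<Rightarrow> real) \<Rightarrow> bool" where
  "AM_map_at_infinity S b T f \<eta> \<longleftrightarrow>
     infpt_map S T f \<and>
     (\<exists>\<theta>. homeomorphism {0..} {0..} \<eta> \<theta>) \<and>
     (\<exists>u. admissible_gauge u \<and>
        (\<forall>x\<in>points S. \<forall>y\<in>points S. \<forall>z\<in>points S. \<forall>w\<in>points S.
           separated S b u x y \<and> separated S b u x z \<and> separated S b u x w \<and>
           separated S b u y z \<and> separated S b u y w \<and> separated S b u z w \<longrightarrow>
           cross_ratio_defined x y z w \<and>
           cross_ratio_defined (f x) (f y) (f z) (f w) \<and>
           cross_ratio T (f x) (f y) (f z) (f w) < \<eta> (cross_ratio S x y z w)))"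

end

theory Submission imports Defs begin

text \<open>If \<open>g\<close> is a coarse inverse of \<open>f\<close>, the quasi-triangle inequality along
  \<open>x\<close>, \<open>g (f x)\<close>, \<open>g (f y)\<close>, \<open>y\<close> bounds \<open>d(x, y)\<close> by a multiple of \<open>d(f x, f y)\<close> plus
  a gauge of \<open>|x| + |y|\<close>. Hence \<open>f\<close> is bi-Lipschitz on pairs separated by a large enough
  gauge, and the cross ratio of pairwise separated points is distorted by at most a constant
  factor. Factors at infinity are \<open>1\<close> on both sides, so Lipschitz constants at least \<open>1\<close>
  cover them too.\<close>

section \<open>Admissible gauges\<close>

text \<open>Monotonicity bounds a gauge from below, so the upper limit in the definition is a limit.\<close>

lemma admissible_gauge_iff_tendsto:
  "admissible_gauge u \<longleftrightarrow> mono_on {0..} u \<and> ((\<lambda>r. u r / r) \<longlongrightarrow> 0) at_top"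
proof
  assume u: "admissible_gauge u"
  then have mono: "mono_on {0..} u" and ls: "Limsup at_top (\<lambda>r. ereal (u r / r)) = 0"
    by (auto simp: admissible_gauge_def)
  have "((\<lambda>r. u 0 / r) \<longlongrightarrow> 0) at_top"
    by (intro tendsto_divide_0[OF tendsto_const] filterlim_at_top_imp_at_infinity filterlim_ident)
  then have lim: "((\<lambda>r. ereal (u 0 / r)) \<longlongrightarrow> 0) at_top"
    by (simp add: zero_ereal_def)
  have ev: "eventually (\<lambda>r. ereal (u 0 / r) \<le> ereal (u r / r)) at_top"
    using eventually_gt_at_top[of "0::real"]
    by eventually_elim (use mono in \<open>auto simp: mono_on_def divide_simps\<close>)
  have "0 = Liminf at_top (\<lambda>r. ereal (u 0 / r))"
    using lim_imp_Liminf[OF _ lim] by simp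
  also have "\<dots> \<le> Liminf at_top (\<lambda>r. ereal (u r / r))"
    by (rule Liminf_mono[OF ev])
  finally have "0 \<le> Liminf at_top (\<lambda>r. ereal (u r / r))" .
  moreover have "Liminf at_top (\<lambda>r. ereal (u r / r)) \<le> Limsup at_top (\<lambda>r. ereal (u r / r))"
    by (rule Liminf_le_Limsup) simp
  ultimately have "((\<lambda>r. ereal (u r / r)) \<longlongrightarrow> 0) at_top"
    using ls by (intro Liminf_eq_Limsup) auto
  then show "mono_on {0..} u \<and> ((\<lambda>r. u r / r) \<longlongrightarrow> 0) at_top"
    using mono by (simp add: zero_ereal_def)
next
  assume u: "mono_on {0..} u \<and> ((\<lambda>r. u r / r) \<longlongrightarrow> 0) at_top"
  then have "((\<lambda>r. ereal (u r / r)) \<longlongrightarrow> 0) at_top"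
    by (simp add: zero_ereal_def)
  then have "Limsup at_top (\<lambda>r. ereal (u r / r)) = 0"
    by (intro lim_imp_Limsup) auto
  then show "admissible_gauge u"
    using u by (simp add: admissible_gauge_def)
qed

lemma admissible_gauge_mono:
  "admissible_gauge u \<Longrightarrow> 0 \<le> r \<Longrightarrow> r \<le> s \<Longrightarrow> u r \<le> u s"
  by (auto simp: admissible_gauge_def mono_on_def)

lemma admissible_gauge_add:
  assumes "admissible_gauge u" "admissible_gauge v"
  shows "admissible_gauge (\<lambda>r. u r + v r)"
  using assms tendsto_add[of "\<lambda>r. u r / r" 0 at_top "\<lambda>r. v r / r" 0]
  by (auto simp: admissible_gauge_iff_tendsto mono_on_def add_divide_distrib intro!: add_mono)

lemma admissible_gauge_cmult:
  assumes "admissible_gauge u" "0 \<le> c"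
  shows "admissible_gauge (\<lambda>r. c * u r)"
  using assms tendsto_mult_left[of "\<lambda>r. u r / r" 0 at_top c]
  by (auto simp: admissible_gauge_iff_tendsto mono_on_def intro!: mult_left_mono)

text \<open>Gauges may be negative. With nonnegative ones, each summand of a sum of gauges is
  bounded by the whole sum, and separated finite points have positive distance.\<close>

lemma admissible_gauge_pos_part:
  assumes "admissible_gauge u"
  shows "admissible_gauge (\<lambda>r. max 0 (u r))"
proof -
  have "((\<lambda>r. max 0 (u r / r)) \<longlongrightarrow> max 0 0) at_top"
    using assms by (intro tendsto_max) (auto simp: admissible_gauge_iff_tendsto)
  moreover have "eventually (\<lambda>r. max 0 (u r / r) = max 0 (u r) / r) at_top"
    using eventually_gt_at_top[of "0::real"]
    by eventually_elim (auto simp: max_def divide_simps)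
  ultimately have "((\<lambda>r. max 0 (u r) / r) \<longlongrightarrow> 0) at_top"
    using tendsto_cong by force
  then show ?thesis
    using assms by (fastforce simp: admissible_gauge_iff_tendsto mono_on_def max_def)
qed

text \<open>With s = a * r + m, the quotient u(s) / r is the product of u(s) / s, which tends to 0,
  and s / r, which tends to a. This turns a gauge of the sizes of image points into a gauge of the
  sizes of the original points.\<close>

lemma admissible_gauge_affine:
  assumes u: "admissible_gauge u" and a: "0 < a" and m: "0 \<le> m"
  shows "admissible_gauge (\<lambda>r. u (a * r + m))"
proof -
  have "filterlim (\<lambda>r. a * r) at_top at_top"
    using a by (intro filterlim_tendsto_pos_mult_at_top[OF tendsto_const] filterlim_ident)
  then have lim: "filterlim (\<lambda>r. a * r + m) at_top at_top"
    by (subst add.commute) (rule filterlim_tendsto_add_at_top[OF tendsto_const])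
  have "((\<lambda>r. u (a * r + m) / (a * r + m)) \<longlongrightarrow> 0) at_top"
    using u filterlim_compose[OF _ lim, of "\<lambda>s. u s / s"]
    by (auto simp: admissible_gauge_iff_tendsto)
  moreover have "((\<lambda>r. a + m / r) \<longlongrightarrow> a + 0) at_top"
    by (intro tendsto_intros tendsto_divide_0[OF tendsto_const]
        filterlim_at_top_imp_at_infinity filterlim_ident)
  ultimately have "((\<lambda>r. u (a * r + m) / (a * r + m) * (a + m / r)) \<longlongrightarrow> 0) at_top"
    using tendsto_mult by fastforce
  moreover have "eventually (\<lambda>r. u (a * r + m) / (a * r + m) * (a + m / r) = u (a * r + m) / r) at_top"
    using eventually_gt_at_top[of "0::real"]
  proof eventually_elim
    case (elim r)
    then have "a * r + m > 0"
      using a m by (simp add: add_pos_nonneg)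
    moreover have "a + m / r = (a * r + m) / r"
      using elim by (simp add: field_simps)
    ultimately show ?case by simp
  qed
  ultimately have "((\<lambda>r. u (a * r + m) / r) \<longlongrightarrow> 0) at_top"
    using tendsto_cong by force
  then show ?thesis
    using u a m by (auto simp: admissible_gauge_iff_tendsto mono_on_def)
qed

text \<open>Sublinearity gives the bound for large r and monotonicity gives it on the remaining
  bounded interval. It serves to show that |f x| grows at most affinely in |x|.\<close>

lemma admissible_gauge_affine_bound:
  assumes u: "admissible_gauge u"
  obtains m where "0 \<le> m" "\<And>r. 0 \<le> r \<Longrightarrow> u r \<le> r + m"
proof -
  have "eventually (\<lambda>r. u r / r < 1) at_top"
    using u by (intro order_tendstoD(2)[of _ 0]) (auto simp: admissible_gauge_iff_tendsto)
  then obtain r0 where r0: "\<And>r. r0 \<le> r \<Longrightarrow> u r / r < 1"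
    by (auto simp: eventually_at_top_linorder)
  \<comment> \<open>The 1 keeps r positive for r at least s, so that u r / r < 1 can be multiplied
    out.\<close>
  define s where "s = max 1 r0"
  have "u r \<le> r + max 0 (u s)" if "0 \<le> r" for r
  proof (cases "s \<le> r")
    case True
    then have "u r < r"
      using r0[of r] by (simp add: s_def divide_simps split: if_splits)
    then show ?thesis by simp
  next
    case False
    then show ?thesis
      using admissible_gauge_mono[OF u \<open>0 \<le> r\<close>, of s] \<open>0 \<le> r\<close> by simp
  qed
  then show ?thesis
    using that[of "max 0 (u s)"] by simp
qed

section \<open>Quasimetric spaces\<close>

lemma fdist_nonneg [simp]: "0 \<le> fdist S x y"
  by (simp add: fdist_def)

lemma quasimetric_space_sym:
  "quasimetric_space S \<Longrightarrow> x \<in> finpts S \<Longrightarrow> y \<in> finpts S \<Longrightarrow> fdist S x y = fdist S y x"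
  by (simp add: quasimetric_space_def quasimetric_def finpts_def fdist_def)

text \<open>Moves the comparison from \<open>ennreal\<close> to the reals once and for all, so that
  later estimates are linear arithmetic.\<close>

lemma quasimetric_space_comparison:
  assumes "quasimetric_space S"
  obtains \<rho> K where "K > 0"
    "\<And>x. x \<in> finpts S \<Longrightarrow> \<rho> x x = 0"
    "\<And>x y z. x \<in> finpts S \<Longrightarrow> y \<in> finpts S \<Longrightarrow> z \<in> finpts S \<Longrightarrow> \<rho> x z \<le> \<rho> x y + \<rho> y z"
    "\<And>x y. x \<in> finpts S \<Longrightarrow> y \<in> finpts S \<Longrightarrow> fdist S x y \<le> K * \<rho> x y"
    "\<And>x y. x \<in> finpts S \<Longrightarrow> y \<in> finpts S \<Longrightarrow> \<rho> x y \<le> K * fdist S x y"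
proof -
  obtain \<rho> K where em: "extended_metric (points S) (infpt S) \<rho>" and K: "K > 0"
    and comp: "\<And>x y. x \<in> points S \<Longrightarrow> y \<in> points S \<Longrightarrow>
      ennreal (1 / K) * \<rho> x y \<le> qdist S x y \<and> qdist S x y \<le> ennreal K * \<rho> x y"
    using assms unfolding quasimetric_space_def quasimetric_def by blast
  have fin: "\<rho> x y \<noteq> \<infinity>" if "x \<in> finpts S" "y \<in> finpts S" for x y
    using em that unfolding extended_metric_def finpts_def by blast
  interpret M: Metric_space "finpts S"
    "\<lambda>x y. if x \<in> finpts S \<and> y \<in> finpts S then enn2real (\<rho> x y) else 0"
    using em by (simp add: extended_metric_def finpts_def)
  have bounds: "fdist S x y \<le> K * enn2real (\<rho> x y) \<and> enn2real (\<rho> x y) \<le> K * fdist S x y"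
    if xy: "x \<in> finpts S" "y \<in> finpts S" for x y
  proof -
    obtain r where r: "\<rho> x y = ennreal r" "0 \<le> r"
      using fin[OF xy] by (cases "\<rho> x y") auto
    have le: "ennreal (r / K) \<le> qdist S x y" "qdist S x y \<le> ennreal (K * r)"
      using comp[of x y] xy r K by (auto simp: finpts_def simp flip: ennreal_mult)
    \<comment> \<open>Finiteness matters here: \<open>enn2real\<close> sends infinity to 0, which
      would break the bound of \<open>\<rho>\<close> by \<open>fdist\<close>. The upper bound in
      \<open>le\<close> provides it.\<close>
    obtain s where s: "qdist S x y = ennreal s" "0 \<le> s"
      using le(2) by (cases "qdist S x y") (auto simp: top_unique)
    show ?thesis
      using le r s K by (auto simp: fdist_def ennreal_le_iff field_simps)
  qed
  show ?thesis
  proof (rule that[of K "\<lambda>x y. enn2real (\<rho> x y)"])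
    show "enn2real (\<rho> x x) = 0" if "x \<in> finpts S" for x
      using M.mdist_zero[OF that] that by simp
    show "enn2real (\<rho> x z) \<le> enn2real (\<rho> x y) + enn2real (\<rho> y z)"
      if "x \<in> finpts S" "y \<in> finpts S" "z \<in> finpts S" for x y z
      using M.triangle[OF that] that by simp
  qed (use K bounds in auto)
qed

lemma quasimetric_space_refl:
  assumes S: "quasimetric_space S" and x: "x \<in> finpts S"
  shows "fdist S x x = 0"
proof (rule quasimetric_space_comparison[OF S])
  fix \<rho> K
  assume "\<And>x. x \<in> finpts S \<Longrightarrow> \<rho> x x = (0::real)"
    and "\<And>x y. x \<in> finpts S \<Longrightarrow> y \<in> finpts S \<Longrightarrow> fdist S x y \<le> K * \<rho> x y"
  from this(1)[OF x] this(2)[OF x x] show ?thesis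
    using fdist_nonneg[of S x x] by simp
qed

text \<open>The whole chain is estimated in the metric \<open>\<rho>\<close>, so one passage to
  \<open>\<rho>\<close> and one back cost only the constant K * K.\<close>

lemma quasimetric_space_triangle4:
  assumes S: "quasimetric_space S"
  obtains A where "A > 0"
    "\<And>x p q y. x \<in> finpts S \<Longrightarrow> p \<in> finpts S \<Longrightarrow> q \<in> finpts S \<Longrightarrow> y \<in> finpts S \<Longrightarrow>
      fdist S x y \<le> A * (fdist S x p + fdist S p q + fdist S q y)"
proof (rule quasimetric_space_comparison[OF S])
  fix \<rho> K
  assume K: "K > 0"
    and tri: "\<And>x y z. x \<in> finpts S \<Longrightarrow> y \<in> finpts S \<Longrightarrow> z \<in> finpts S \<Longrightarrow> \<rho> x z \<le> \<rho> x y + \<rho> y z"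
    and up: "\<And>x y. x \<in> finpts S \<Longrightarrow> y \<in> finpts S \<Longrightarrow> fdist S x y \<le> K * \<rho> x y"
    and lo: "\<And>x y. x \<in> finpts S \<Longrightarrow> y \<in> finpts S \<Longrightarrow> \<rho> x y \<le> K * fdist S x y"
  have "fdist S x y \<le> (K * K) * (fdist S x p + fdist S p q + fdist S q y)"
    if p: "x \<in> finpts S" "p \<in> finpts S" "q \<in> finpts S" "y \<in> finpts S" for x p q y
  proof -
    have "\<rho> x y \<le> K * fdist S x p + K * fdist S p q + K * fdist S q y"
      using tri[of x p y] tri[of p q y] lo[of x p] lo[of p q] lo[of q y] p by linarith
    then have "K * \<rho> x y \<le> K * (K * fdist S x p + K * fdist S p q + K * fdist S q y)"
      using K by (intro mult_left_mono) auto
    then show ?thesis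
      using up[of x y] p by (simp add: algebra_simps)
  qed
  then show thesis
    using that[of "K * K"] K by simp
qed

section \<open>Distortion of distances and cross ratios\<close>

text \<open>All additive errors are collected in one gauge \<open>U\<close>; on pairs farther apart
  than \<open>U\<close> they are absorbed into the distance. Constants at least 1 are requested so
  that the same bounds hold for factors equal to 1.\<close>

lemma SBE_map_bilipschitz_separated:
  assumes S: "quasimetric_space S" and b: "b \<in> finpts S" and f: "SBE_map S b T f"
  obtains U A B where "admissible_gauge U" "\<And>r. 0 \<le> U r" "1 \<le> A" "1 \<le> B"
    "\<And>x y. x \<in> finpts S \<Longrightarrow> y \<in> finpts S \<Longrightarrow> U (fdist S b x + fdist S b y) < fdist S x y \<Longrightarrow>
      fdist T (f x) (f y) \<le> A * fdist S x y \<and> fdist S x y \<le> B * fdist T (f x) (f y)"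
proof -
  obtain u C C' where u: "admissible_gauge u" and C: "C > 0" "C' > 0"
    and lip_f: "\<And>x y. x \<in> finpts S \<Longrightarrow> y \<in> finpts S \<Longrightarrow>
      fdist T (f x) (f y) \<le> C * fdist S x y + C' * u (fdist S b x + fdist S b y)"
    and f_fin: "\<And>x. x \<in> finpts S \<Longrightarrow> f x \<in> finpts T"
    using f unfolding SBE_map_def sublinear_lipschitz_def infpt_map_def by blast
  obtain g where g: "sublinear_lipschitz T (f b) S g" and gf: "sublinear_equivalent S b S (g \<circ> f) id"
    using f unfolding SBE_map_def by blast
  obtain w D D' where w: "admissible_gauge w" and D: "D > 0" "D' > 0"
    and lip_g: "\<And>x y. x \<in> finpts T \<Longrightarrow> y \<in> finpts T \<Longrightarrow>
      fdist S (g x) (g y) \<le> D * fdist T x y + D' * w (fdist T (f b) x + fdist T (f b) y)"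
    and g_fin: "\<And>x. x \<in> finpts T \<Longrightarrow> g x \<in> finpts S"
    using g unfolding sublinear_lipschitz_def infpt_map_def by blast
  obtain v E where v: "admissible_gauge v" and E: "E > 0"
    and close: "\<And>x. x \<in> finpts S \<Longrightarrow> fdist S (g (f x)) x \<le> E * v (fdist S b x)"
    using gf unfolding sublinear_equivalent_def by auto
  obtain A where A: "A > 0" and tri: "\<And>x p q y. x \<in> finpts S \<Longrightarrow> p \<in> finpts S \<Longrightarrow>
      q \<in> finpts S \<Longrightarrow> y \<in> finpts S \<Longrightarrow> fdist S x y \<le> A * (fdist S x p + fdist S p q + fdist S q y)"
    using quasimetric_space_triangle4[OF S] by blast
  obtain m where m: "0 \<le> m" "\<And>r. 0 \<le> r \<Longrightarrow> u r \<le> r + m"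
    using admissible_gauge_affine_bound[OF u] by blast
  \<comment> \<open>These come from |f x| \<le> a * |x| + C' * m, which is the Lipschitz bound for
    the pair b, x, where |b| = 0; adding it for two points doubles the constant term.\<close>
  define a k where "a = C + C'" and "k = 2 * (C' * m)"
  have ak: "0 < a" "0 \<le> k"
    using C m by (auto simp: a_def k_def)
  have size: "fdist T (f b) (f x) \<le> a * fdist S b x + C' * m" if x: "x \<in> finpts S" for x
  proof -
    have "C' * u (fdist S b x) \<le> C' * (fdist S b x + m)"
      using C m(2) by (intro mult_left_mono) auto
    then show ?thesis
      using lip_f[OF b x] quasimetric_space_refl[OF S b] by (simp add: a_def algebra_simps)
  qed
  \<comment> \<open>The first summand is the error of \<open>f\<close>. The other two are twice the
    errors from \<open>g \<circ> f\<close> (at both endpoints, hence 4) and from \<open>g\<close>,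
    so that the error in the lower bound is at most half of \<open>U\<close>.\<close>
  define U where "U = (\<lambda>r. C' * max 0 (u r) +
    (4 * (A * E) * max 0 (v r) + 2 * (A * D') * max 0 (w (a * r + k))))"
  have U: "admissible_gauge U"
    unfolding U_def using u v w C A D E ak
    by (intro admissible_gauge_add admissible_gauge_cmult admissible_gauge_pos_part
        admissible_gauge_affine) auto
  have U0: "0 \<le> U r" for r
    using C A D E by (simp add: U_def)
  have "fdist T (f x) (f y) \<le> (C + 1) * fdist S x y \<and>
      fdist S x y \<le> (2 * (A * D) + 1) * fdist T (f x) (f y)"
    if x: "x \<in> finpts S" and y: "y \<in> finpts S"
      and sep: "U (fdist S b x + fdist S b y) < fdist S x y" for x y
  proof
    let ?r = "fdist S b x + fdist S b y" and ?d = "fdist T (f x) (f y)"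
    have nn: "0 \<le> C' * max 0 (u ?r)" "0 \<le> A * E * max 0 (v ?r)"
      "0 \<le> A * D' * max 0 (w (a * ?r + k))"
      using C A D E by auto
    have "C' * u ?r \<le> C' * max 0 (u ?r)"
      using C by (intro mult_left_mono) auto
    then show "?d \<le> (C + 1) * fdist S x y"
      using lip_f[OF x y] sep nn by (simp add: U_def algebra_simps)
    have near: "fdist S (g (f z)) z \<le> E * max 0 (v ?r)"
      if z: "z \<in> finpts S" "fdist S b z \<le> ?r" for z
    proof -
      have "v (fdist S b z) \<le> max 0 (v ?r)"
        using admissible_gauge_mono[OF v fdist_nonneg z(2)] by simp
      then have "E * v (fdist S b z) \<le> E * max 0 (v ?r)"
        using E by (intro mult_left_mono) auto
      then show ?thesis
        using close[OF z(1)] by simp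
    qed
    have "fdist T (f b) (f x) + fdist T (f b) (f y) \<le> a * ?r + k"
      using size[OF x] size[OF y] by (simp add: k_def distrib_left)
    then have "w (fdist T (f b) (f x) + fdist T (f b) (f y)) \<le> w (a * ?r + k)"
      by (intro admissible_gauge_mono[OF w]) auto
    then have "w (fdist T (f b) (f x) + fdist T (f b) (f y)) \<le> max 0 (w (a * ?r + k))"
      by simp
    then have "D' * w (fdist T (f b) (f x) + fdist T (f b) (f y)) \<le> D' * max 0 (w (a * ?r + k))"
      using D by (intro mult_left_mono) auto
    then have mid: "fdist S (g (f x)) (g (f y)) \<le> D * ?d + D' * max 0 (w (a * ?r + k))"
      using lip_g[OF f_fin[OF x] f_fin[OF y]] by simp
    have "fdist S x (g (f x)) = fdist S (g (f x)) x"
      using quasimetric_space_sym[OF S] x f_fin g_fin by blast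
    then have "fdist S x (g (f x)) + fdist S (g (f x)) (g (f y)) + fdist S (g (f y)) y
        \<le> 2 * (E * max 0 (v ?r)) + D * ?d + D' * max 0 (w (a * ?r + k))"
      using near[OF x] near[OF y] mid by simp
    then have "A * (fdist S x (g (f x)) + fdist S (g (f x)) (g (f y)) + fdist S (g (f y)) y)
        \<le> A * (2 * (E * max 0 (v ?r)) + D * ?d + D' * max 0 (w (a * ?r + k)))"
      using A by (intro mult_left_mono) auto
    then have "fdist S x y \<le> A * (2 * (E * max 0 (v ?r)) + D * ?d + D' * max 0 (w (a * ?r + k)))"
      using tri[OF x g_fin[OF f_fin[OF x]] g_fin[OF f_fin[OF y]] y] by simp
    moreover have "A * (2 * (E * max 0 (v ?r)) + D * ?d + D' * max 0 (w (a * ?r + k)))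
        = 2 * (A * E * max 0 (v ?r)) + A * D * ?d + A * D' * max 0 (w (a * ?r + k))"
      by (simp add: algebra_simps)
    \<comment> \<open>Doubling leaves one copy of the distance after \<open>U ?r\<close> is absorbed
      by separation. The extra \<open>?d\<close> added next only raises the constant to at least
      1.\<close>
    ultimately have "2 * fdist S x y \<le> U ?r + 2 * (A * D * ?d)"
      using nn by (simp add: U_def)
    then have "fdist S x y \<le> 2 * (A * D * ?d) + ?d"
      using sep fdist_nonneg[of T "f x" "f y"] by linarith
    then show "fdist S x y \<le> (2 * (A * D) + 1) * ?d"
      by (simp add: algebra_simps)
  qed
  then show ?thesis
    using that[of U "C + 1" "2 * (A * D) + 1"] U U0 C A D by simp
qed

text \<open>Numerators are controlled by the upper Lipschitz bound and denominators by the lower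
  one; two factors of each kind give the square.\<close>

lemma cross_ratio_distortion:
  fixes p q r s p' q' r' s' A B :: real
  assumes pos: "0 < p" "0 < q" "0 < r" "0 < s" "0 < p'" "0 < q'" "0 < r'" "0 < s'"
    and AB: "0 < A" "0 < B"
    and le: "p' \<le> A * p" "q' \<le> A * q" "r \<le> B * r'" "s \<le> B * s'"
  shows "(p' * q') / (r' * s') \<le> (A * B)\<^sup>2 * ((p * q) / (r * s))"
proof -
  have "p' * q' \<le> (A * p) * (A * q)" "r * s \<le> (B * r') * (B * s')"
    using assms by (auto intro!: mult_mono)
  then have "(p' * q') * (r * s) \<le> ((A * p) * (A * q)) * ((B * r') * (B * s'))"
    using pos AB by (intro mult_mono[of _ _ "r * s"]) auto
  then have "(p' * q') * (r * s) \<le> (A * B)\<^sup>2 * (p * q) * (r' * s')"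
    by (simp add: power2_eq_square mult_ac)
  then show ?thesis
    using pos by (simp add: divide_simps mult_ac)
qed

theorem proposition3p3:
  fixes S :: "'a qspace" and T :: "'b qspace" and b :: 'a and f :: "'a \<Rightarrow> 'b"
  assumes "quasimetric_space S"
    and "quasimetric_space T"
    and "b \<in> finpts S"
    and "SBE_map S b T f"
  shows "\<exists>L>0. AM_map_at_infinity S b T f (\<lambda>t. L * t)"
proof -
  obtain U A B where U: "admissible_gauge U" "\<And>r. 0 \<le> U r" and AB: "1 \<le> A" "1 \<le> B"
    and bilip: "\<And>x y. x \<in> finpts S \<Longrightarrow> y \<in> finpts S \<Longrightarrow>
      U (fdist S b x + fdist S b y) < fdist S x y \<Longrightarrow>
      fdist T (f x) (f y) \<le> A * fdist S x y \<and> fdist S x y \<le> B * fdist T (f x) (f y)"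
    using SBE_map_bilipschitz_separated[OF assms(1,3,4)] by blast
  have ext: "infpt_map S T f"
    using assms(4) by (simp add: SBE_map_def sublinear_lipschitz_def)
  have inf: "f (infpt S) = infpt T" and fin: "f x \<noteq> infpt T" "f x \<in> finpts T"
    if "x \<in> finpts S" for x
    using ext that by (auto simp: infpt_map_def finpts_def)
  \<comment> \<open>For finite points, U \<ge> 0 makes the distance positive, and the lower
    Lipschitz bound carries this over to the images. If one point is at infinity, both factors are 1
    and the bounds reduce to A, B \<ge> 1.\<close>
  have pair: "x \<noteq> y \<and> f x \<noteq> f y \<and> 0 < cr_factor S x y \<and> 0 < cr_factor T (f x) (f y) \<and>
      cr_factor T (f x) (f y) \<le> A * cr_factor S x y \<and>
      cr_factor S x y \<le> B * cr_factor T (f x) (f y)"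
    if sep: "separated S b U x y" for x y
  proof (cases "x \<in> finpts S \<and> y \<in> finpts S")
    case True
    then have xy: "x \<in> finpts S" "y \<in> finpts S" "U (fdist S b x + fdist S b y) < fdist S x y"
      using sep by (auto simp: separated_def finpts_def)
    then have pos: "0 < fdist S x y"
      using U(2) by (meson le_less_trans)
    have le: "fdist T (f x) (f y) \<le> A * fdist S x y" "fdist S x y \<le> B * fdist T (f x) (f y)"
      using bilip[OF xy] by auto
    then have pos': "0 < fdist T (f x) (f y)"
      using pos AB by (metis fdist_nonneg less_le_trans mult_zero_right order_le_less not_less)
    have "x \<noteq> y" "f x \<noteq> f y"
      using pos pos' quasimetric_space_refl[OF assms(1) xy(1)]
        quasimetric_space_refl[OF assms(2) fin(2)[OF xy(1)]] by auto
    then show ?thesis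
      using xy fin pos pos' le by (auto simp: cr_factor_def finpts_def)
  next
    case False
    then show ?thesis
      using sep inf fin(1) AB by (auto simp: separated_def cr_factor_def finpts_def)
  qed
  have sym: "separated S b U x y \<Longrightarrow> separated S b U y x" for x y
    using quasimetric_space_sym[OF assms(1), of x y] by (auto simp: separated_def add.commute)
  \<comment> \<open>The added 1 makes the inequality strict, since the cross ratio of the separated
    points is positive.\<close>
  define L where "L = (A * B)\<^sup>2 + 1"
  have L: "0 < L"
    by (simp add: L_def add_nonneg_pos)
  \<comment> \<open>The four pairs are those whose factors occur in the cross ratio. By
    \<open>pair\<close> they consist of distinct points with distinct images, so both cross ratios
    are defined and neither falls under the zero convention.\<close>
  have "cross_ratio_defined x y z w \<and> cross_ratio_defined (f x) (f y) (f z) (f w) \<and>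
      cross_ratio T (f x) (f y) (f z) (f w) < L * cross_ratio S x y z w"
    if sep: "separated S b U x z" "separated S b U x w" "separated S b U y z" "separated S b U y w"
    for x y z w
  proof -
    note P = sep[THEN pair]
    let ?t = "(cr_factor S x z * cr_factor S y w) / (cr_factor S x w * cr_factor S y z)"
    have "(cr_factor T (f x) (f z) * cr_factor T (f y) (f w)) /
        (cr_factor T (f x) (f w) * cr_factor T (f y) (f z)) \<le> (A * B)\<^sup>2 * ?t"
      using P AB by (intro cross_ratio_distortion) auto
    also have "\<dots> < L * ?t"
      using P by (intro mult_strict_right_mono) (simp_all add: L_def)
    finally show ?thesis
      using P by (simp add: cross_ratio_defined_def cross_ratio_def)
  qed
  moreover have "homeomorphism {0..} {0..} (\<lambda>t. L * t) (\<lambda>t. t / L)"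
    using L by (intro homeomorphismI) (auto intro!: continuous_intros)
  ultimately have "AM_map_at_infinity S b T f (\<lambda>t. L * t)"
    unfolding AM_map_at_infinity_def using U(1) ext by blast
  then show ?thesis
    using L by blast
qed

end
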